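(* Let $T\in\mathcal F$ be a trigraph with no balanced skew-partition and let $X$ be a fragment of $T$. Then the block of decomposition $T_X$ belongs to $\mathcal F$.
   Context: Trigraphs: a finite vertex set $V(T)$ with $\theta:\binom{V(T)}{2}\to\{-1,0,1\}$; $u,v$ strongly adjacent if $\theta(uv)=1$, strongly antiadjacent if $-1$, a switchable pair if $0$; adjacent if $\theta\in\{0,1\}$, antiadjacent if $\theta\in\{-1,0\}$. Complement $\overline T$: adjacency $-\theta$; $T|X$: induced trigraph. Strongly complete/anticomplete: strongly adjacent/antiadjacent to all vertices of a set. Full realization: graph on $V(T)$ of adjacent pairs. $X$ connected: full realization of $T|X$ connected; anticonnected: complement of the graph on $X$ of strongly adjacent pairs connected; components = maximal connected subsets. Path: distinct $p_1,\dots,p_k$, consecutive adjacent, non-consecutive antiadjacent (length $k-1$, interior = inner vertices). Hole: distinct $h_1,\dots,h_k$, $k\ge4$, $h_i,h_j$ adjacent iff $|i-j|\in\{1,k-1\}$, otherwise antiadjacent (length $k$). Antipath/antihole: induced subtrigraph whose complement is a path/hole in $\overline T$. Berge: no odd hole and no odd antihole. Skew-partition: partition $(A,B)$ of $V(T)$, $A$ not connected, $B$ not anticonnected; balanced if no path of odd length $>1$ has ends in $B$ and interior in $A$, and no antipath of odd length $>1$ has ends in $A$ and interior in $B$. $\mathcal F$: with $\Sigma(T)$ the graph of switchable pairs, $T\in\mathcal F$ iff $T$ is Berge, each component of $\Sigma(T)$ has at most two edges, and each vertex $v$ of degree two in $\Sigma(T)$ with $\Sigma(T)$-neighbours $x,y$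 is either strongly complete to $V(T)\setminus\{v,x,y\}$ with $x,y$ strongly adjacent, or strongly anticomplete to $V(T)\setminus\{v,x,y\}$ with $x,y$ strongly antiadjacent. $2$-join: a partition $(X_1,X_2)$ of $V(T)$ with disjoint sets $A_1,B_1,C_1,A_2,B_2,C_2$ (a split), $X_i=A_i\cup B_i\cup C_i$, $A_1,A_2,B_1,B_2\neq\emptyset$, no switchable pair meeting both $X_1,X_2$, $A_1$ strongly complete to $A_2$, $B_1$ strongly complete to $B_2$, all other pairs between $X_1$ and $X_2$ strongly antiadjacent, $|X_i|\ge3$, and if $|A_i|=|B_i|=1$ the full realization of $T|X_i$ is not a path of length two between the vertices of $A_i$ and $B_i$. Proper: for $i=1,2$ each component of $T|X_i$ meets $A_i$ and $B_i$. A (proper) complement $2$-join of $T$ is a (proper) $2$-join of $\overline T$, with the same split. For a Berge trigraph and a proper $2$-join, all paths with one end in $A_i$, the other in $B_i$ and interior in $C_i$ ($i=1,2$) have lengths of the same parity; the $2$-join is odd or even accordingly; a complement $2$-join is odd/even if it is so as a $2$-join of $\overline T$. Fragment: $X\subseteq V(T)$ such that $(X,V(T)\setminus X)$ is a proper $2$-join or a proper complement $2$-join of $T$. Block $T_X$ (with $X=X_1$ and a split $(A_1,B_1,C_1,A_2,B_2,C_2)$ of $(X_1,X_2)$), starting from $T|X_1$ and adding new marker vertices, with all pairs not specified strongly antiadjacent: odd $2$-join: add $a,b$ with $a$ strongly complete to $A_1$, $b$ strongly complete to $B_1$, $ab$ switchable. Even $2$-join: add $a,b,c$ with $a$ strongly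 complete to $A_1$, $b$ strongly complete to $B_1$, $ac$ and $cb$ switchable pairs. Odd complement $2$-join: add $a,b$ with $a$ strongly complete to $B_1\cup C_1$, $b$ strongly complete to $A_1\cup C_1$, $ab$ switchable. Even complement $2$-join: add $a,b,c$ with $a$ strongly complete to $B_1\cup C_1$, $b$ strongly complete to $A_1\cup C_1$, $c$ strongly complete to $X_1$, $ac,cb$ switchable pairs, $ab$ strongly adjacent. *)

theory Defs
  imports Main
begin

section \<open>Trigraphs\<close>

text \<open>The adjacency function is applied to unordered pairs, i.e. two-element sets of vertices; its
  values on all other sets are irrelevant.\<close>

datatype 'a trigraph = Trigraph (verts: "'a set") (theta: "'a set \<Rightarrow> int")

definition trigraph :: "'a trigraph \<Rightarrow> bool" where
  "trigraph T \<longleftrightarrow> finite (verts T) \<and>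
     (\<forall>e. e \<subseteq> verts T \<and> card e = 2 \<longrightarrow> theta T e \<in> {-1, 0, 1})"

definition vertex_pair :: "'a trigraph \<Rightarrow> 'a \<Rightarrow> 'a \<Rightarrow> bool" where
  "vertex_pair T u v \<longleftrightarrow> u \<in> verts T \<and> v \<in> verts T \<and> u \<noteq> v"

definition strongly_adjacent :: "'a trigraph \<Rightarrow> 'a \<Rightarrow> 'a \<Rightarrow> bool" where
  "strongly_adjacent T u v \<longleftrightarrow> vertex_pair T u v \<and> theta T {u, v} = 1"

definition strongly_antiadjacent :: "'a trigraph \<Rightarrow> 'a \<Rightarrow> 'a \<Rightarrow> bool" where
  "strongly_antiadjacent T u v \<longleftrightarrow> vertex_pair T u v \<and> theta T {u, v} = -1"

definition switchable :: "'a trigraph \<Rightarrow> 'a \<Rightarrow> 'a \<Rightarrow> bool" where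
  "switchable T u v \<longleftrightarrow> vertex_pair T u v \<and> theta T {u, v} = 0"

definition adjacent :: "'a trigraph \<Rightarrow> 'a \<Rightarrow> 'a \<Rightarrow> bool" where
  "adjacent T u v \<longleftrightarrow> vertex_pair T u v \<and> theta T {u, v} \<in> {0, 1}"

definition antiadjacent :: "'a trigraph \<Rightarrow> 'a \<Rightarrow> 'a \<Rightarrow> bool" where
  "antiadjacent T u v \<longleftrightarrow> vertex_pair T u v \<and> theta T {u, v} \<in> {-1, 0}"

definition complement :: "'a trigraph \<Rightarrow> 'a trigraph" where
  "complement T = Trigraph (verts T) (\<lambda>e. - theta T e)"

definition induced :: "'a trigraph \<Rightarrow> 'a set \<Rightarrow> 'a trigraph" where
  "induced T X = Trigraph X (theta T)"

definition strongly_complete :: "'a trigraph \<Rightarrow> 'a set \<Rightarrow> 'a set \<Rightarrow> bool" where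
  "strongly_complete T X Y \<longleftrightarrow> (\<forall>u\<in>X. \<forall>v\<in>Y. strongly_adjacent T u v)"

definition strongly_anticomplete :: "'a trigraph \<Rightarrow> 'a set \<Rightarrow> 'a set \<Rightarrow> bool" where
  "strongly_anticomplete T X Y \<longleftrightarrow> (\<forall>u\<in>X. \<forall>v\<in>Y. strongly_antiadjacent T u v)"


section \<open>Connectivity\<close>

text \<open>A graph is given by its vertex set and its edge relation, which is taken to be restricted to
  the vertex set. The graph without vertices is connected, so both sides of a
  skew-partition are nonempty.\<close>

definition graph_connected :: "'a set \<Rightarrow> ('a \<Rightarrow> 'a \<Rightarrow> bool) \<Rightarrow> bool" where
  "graph_connected V E \<longleftrightarrow>
     (\<forall>u\<in>V. \<forall>v\<in>V. (\<lambda>x y. x \<in> V \<and> y \<in> V \<and> E x y)\<^sup>*\<^sup>* u v)"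

definition graph_component :: "'a set \<Rightarrow> ('a \<Rightarrow> 'a \<Rightarrow> bool) \<Rightarrow> 'a set \<Rightarrow> bool" where
  "graph_component V E Y \<longleftrightarrow> Y \<subseteq> V \<and> graph_connected Y E \<and>
     (\<forall>Z. Y \<subseteq> Z \<and> Z \<subseteq> V \<and> graph_connected Z E \<longrightarrow> Z = Y)"

definition connected :: "'a trigraph \<Rightarrow> 'a set \<Rightarrow> bool" where
  "connected T X \<longleftrightarrow> graph_connected X (adjacent (induced T X))"

definition anticonnected :: "'a trigraph \<Rightarrow> 'a set \<Rightarrow> bool" where
  "anticonnected T X \<longleftrightarrow>
     graph_connected X (\<lambda>u v. u \<noteq> v \<and> \<not> strongly_adjacent (induced T X) u v)"

definition component :: "'a trigraph \<Rightarrow> 'a set \<Rightarrow> bool" where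
  "component T Y \<longleftrightarrow> Y \<subseteq> verts T \<and> connected T Y \<and>
     (\<forall>Z. Y \<subseteq> Z \<and> Z \<subseteq> verts T \<and> connected T Z \<longrightarrow> Z = Y)"


section \<open>Paths, holes and Berge trigraphs\<close>

definition path :: "'a trigraph \<Rightarrow> 'a list \<Rightarrow> bool" where
  "path T p \<longleftrightarrow> p \<noteq> [] \<and> distinct p \<and> set p \<subseteq> verts T \<and>
     (\<forall>i j. i < j \<and> j < length p \<longrightarrow>
        (if j - i = 1 then adjacent T (p ! i) (p ! j) else antiadjacent T (p ! i) (p ! j)))"

definition path_length :: "'a list \<Rightarrow> nat" where
  "path_length p = length p - 1"

definition interior :: "'a list \<Rightarrow> 'a set" where
  "interior p = set (butlast (tl p))"

text \<open>The conditions on a hole are not exclusive: a switchable pair may occur as a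
  consecutive or as a non-consecutive pair, exactly as for paths.\<close>

definition hole :: "'a trigraph \<Rightarrow> 'a list \<Rightarrow> bool" where
  "hole T h \<longleftrightarrow> 4 \<le> length h \<and> distinct h \<and> set h \<subseteq> verts T \<and>
     (\<forall>i j. i < j \<and> j < length h \<longrightarrow>
        (if j - i \<in> {1, length h - 1} then adjacent T (h ! i) (h ! j)
         else antiadjacent T (h ! i) (h ! j)))"

definition antipath :: "'a trigraph \<Rightarrow> 'a list \<Rightarrow> bool" where
  "antipath T p \<longleftrightarrow> path (complement T) p"

definition antihole :: "'a trigraph \<Rightarrow> 'a list \<Rightarrow> bool" where
  "antihole T h \<longleftrightarrow> hole (complement T) h"

definition Berge :: "'a trigraph \<Rightarrow> bool" where
  "Berge T \<longleftrightarrow> (\<nexists>h. hole T h \<and> odd (length h)) \<and> (\<nexists>h. antihole T h \<and> odd (length h))"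


section \<open>Balanced skew-partitions\<close>

definition skew_partition :: "'a trigraph \<Rightarrow> 'a set \<Rightarrow> 'a set \<Rightarrow> bool" where
  "skew_partition T A B \<longleftrightarrow> A \<union> B = verts T \<and> A \<inter> B = {} \<and>
     \<not> connected T A \<and> \<not> anticonnected T B"

definition balanced_skew_partition :: "'a trigraph \<Rightarrow> 'a set \<Rightarrow> 'a set \<Rightarrow> bool" where
  "balanced_skew_partition T A B \<longleftrightarrow> skew_partition T A B \<and>
     (\<nexists>p. path T p \<and> odd (path_length p) \<and> 1 < path_length p \<and>
          hd p \<in> B \<and> last p \<in> B \<and> interior p \<subseteq> A) \<and>
     (\<nexists>p. antipath T p \<and> odd (path_length p) \<and> 1 < path_length p \<and>
          hd p \<in> A \<and> last p \<in> A \<and> interior p \<subseteq> B)"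


section \<open>The class F\<close>

definition class_F :: "'a trigraph set" where
  "class_F = {T. trigraph T \<and> Berge T \<and>
     (\<forall>Y. graph_component (verts T) (switchable T) Y \<longrightarrow>
        card {{u, v} | u v. u \<in> Y \<and> v \<in> Y \<and> switchable T u v} \<le> 2) \<and>
     (\<forall>v x y. v \<in> verts T \<and> x \<noteq> y \<and> {w. switchable T v w} = {x, y} \<longrightarrow>
        (strongly_complete T {v} (verts T - {v, x, y}) \<and> strongly_adjacent T x y) \<or>
        (strongly_anticomplete T {v} (verts T - {v, x, y}) \<and> strongly_antiadjacent T x y))}"


section \<open>2-joins\<close>

definition two_join_side :: "'a trigraph \<Rightarrow> 'a set \<Rightarrow> 'a set \<Rightarrow> 'a set \<Rightarrow> bool" where
  "two_join_side T A B C \<longleftrightarrow>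
     A \<inter> B = {} \<and> A \<inter> C = {} \<and> B \<inter> C = {} \<and> A \<noteq> {} \<and> B \<noteq> {} \<and>
     3 \<le> card (A \<union> B \<union> C) \<and>
     (\<forall>a b. A = {a} \<and> B = {b} \<longrightarrow>
        \<not> (\<exists>c. C = {c} \<and> adjacent T a c \<and> adjacent T c b \<and> \<not> adjacent T a b))"

definition two_join ::
  "'a trigraph \<Rightarrow> 'a set \<Rightarrow> 'a set \<Rightarrow> 'a set \<Rightarrow> 'a set \<Rightarrow> 'a set \<Rightarrow> 'a set \<Rightarrow> bool" where
  "two_join T A1 B1 C1 A2 B2 C2 \<longleftrightarrow>
     (let X1 = A1 \<union> B1 \<union> C1; X2 = A2 \<union> B2 \<union> C2 in
        X1 \<union> X2 = verts T \<and> X1 \<inter> X2 = {} \<and>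
        two_join_side T A1 B1 C1 \<and> two_join_side T A2 B2 C2 \<and>
        (\<forall>u\<in>X1. \<forall>v\<in>X2. \<not> switchable T u v) \<and>
        strongly_complete T A1 A2 \<and> strongly_complete T B1 B2 \<and>
        (\<forall>u\<in>X1. \<forall>v\<in>X2. \<not> (u \<in> A1 \<and> v \<in> A2) \<and> \<not> (u \<in> B1 \<and> v \<in> B2)
           \<longrightarrow> strongly_antiadjacent T u v))"

definition proper_side :: "'a trigraph \<Rightarrow> 'a set \<Rightarrow> 'a set \<Rightarrow> 'a set \<Rightarrow> bool" where
  "proper_side T A B C \<longleftrightarrow>
     (\<forall>Y. component (induced T (A \<union> B \<union> C)) Y \<longrightarrow> Y \<inter> A \<noteq> {} \<and> Y \<inter> B \<noteq> {})"

definition proper_two_join ::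
  "'a trigraph \<Rightarrow> 'a set \<Rightarrow> 'a set \<Rightarrow> 'a set \<Rightarrow> 'a set \<Rightarrow> 'a set \<Rightarrow> 'a set \<Rightarrow> bool" where
  "proper_two_join T A1 B1 C1 A2 B2 C2 \<longleftrightarrow> two_join T A1 B1 C1 A2 B2 C2 \<and>
     proper_side T A1 B1 C1 \<and> proper_side T A2 B2 C2"

definition proper_complement_two_join ::
  "'a trigraph \<Rightarrow> 'a set \<Rightarrow> 'a set \<Rightarrow> 'a set \<Rightarrow> 'a set \<Rightarrow> 'a set \<Rightarrow> 'a set \<Rightarrow> bool" where
  "proper_complement_two_join T = proper_two_join (complement T)"

definition fragment :: "'a trigraph \<Rightarrow> 'a set \<Rightarrow> bool" where
  "fragment T X \<longleftrightarrow> (\<exists>A1 B1 C1 A2 B2 C2.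
     X = A1 \<union> B1 \<union> C1 \<and> verts T - X = A2 \<union> B2 \<union> C2 \<and>
     (proper_two_join T A1 B1 C1 A2 B2 C2 \<or> proper_complement_two_join T A1 B1 C1 A2 B2 C2))"

definition side_path :: "'a trigraph \<Rightarrow> 'a set \<Rightarrow> 'a set \<Rightarrow> 'a set \<Rightarrow> 'a list \<Rightarrow> bool" where
  "side_path T A B C p \<longleftrightarrow> path T p \<and> hd p \<in> A \<and> last p \<in> B \<and> interior p \<subseteq> C"

text \<open>For a proper 2-join of a Berge trigraph, side paths exist on both sides and their lengths
  all have the same parity, so such a 2-join is even iff it is not odd.\<close>

definition odd_two_join ::
  "'a trigraph \<Rightarrow> 'a set \<Rightarrow> 'a set \<Rightarrow> 'a set \<Rightarrow> 'a set \<Rightarrow> 'a set \<Rightarrow> 'a set \<Rightarrow> bool" where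
  "odd_two_join T A1 B1 C1 A2 B2 C2 \<longleftrightarrow>
     (\<forall>p. side_path T A1 B1 C1 p \<or> side_path T A2 B2 C2 p \<longrightarrow> odd (path_length p))"


section \<open>Blocks of decomposition\<close>

datatype 'a block_vertex = Orig 'a | Mark_a | Mark_b | Mark_c

definition star :: "'a block_vertex \<Rightarrow> 'a set \<Rightarrow> 'a block_vertex set set" where
  "star m S = {{m, Orig u} | u. u \<in> S}"

text \<open>The trigraph obtained from the one induced on \<open>X\<close> by adding the marker vertices \<open>M\<close>, where
  \<open>S\<close> are the new strongly adjacent pairs and \<open>W\<close> the new switchable pairs; all other new pairs
  are strongly antiadjacent.\<close>

definition add_markers ::
  "'a trigraph \<Rightarrow> 'a set \<Rightarrow> 'a block_vertex set \<Rightarrow> 'a block_vertex set set \<Rightarrow>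
   'a block_vertex set set \<Rightarrow> 'a block_vertex trigraph" where
  "add_markers T X M S W = Trigraph (Orig ` X \<union> M)
     (\<lambda>e. if e \<subseteq> Orig ` X then theta T (Orig -` e)
          else if e \<in> S then 1 else if e \<in> W then 0 else -1)"

definition odd_block :: "'a trigraph \<Rightarrow> 'a set \<Rightarrow> 'a set \<Rightarrow> 'a set \<Rightarrow> 'a block_vertex trigraph" where
  "odd_block T A1 B1 C1 = add_markers T (A1 \<union> B1 \<union> C1) {Mark_a, Mark_b}
     (star Mark_a A1 \<union> star Mark_b B1)
     {{Mark_a, Mark_b}}"

definition even_block :: "'a trigraph \<Rightarrow> 'a set \<Rightarrow> 'a set \<Rightarrow> 'a set \<Rightarrow> 'a block_vertex trigraph" where
  "even_block T A1 B1 C1 = add_markers T (A1 \<union> B1 \<union> C1) {Mark_a, Mark_b, Mark_c}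
     (star Mark_a A1 \<union> star Mark_b B1)
     {{Mark_a, Mark_c}, {Mark_c, Mark_b}}"

definition odd_complement_block ::
  "'a trigraph \<Rightarrow> 'a set \<Rightarrow> 'a set \<Rightarrow> 'a set \<Rightarrow> 'a block_vertex trigraph" where
  "odd_complement_block T A1 B1 C1 = add_markers T (A1 \<union> B1 \<union> C1) {Mark_a, Mark_b}
     (star Mark_a (B1 \<union> C1) \<union> star Mark_b (A1 \<union> C1))
     {{Mark_a, Mark_b}}"

definition even_complement_block ::
  "'a trigraph \<Rightarrow> 'a set \<Rightarrow> 'a set \<Rightarrow> 'a set \<Rightarrow> 'a block_vertex trigraph" where
  "even_complement_block T A1 B1 C1 = add_markers T (A1 \<union> B1 \<union> C1) {Mark_a, Mark_b, Mark_c}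
     (star Mark_a (B1 \<union> C1) \<union> star Mark_b (A1 \<union> C1) \<union> star Mark_c (A1 \<union> B1 \<union> C1)
        \<union> {{Mark_a, Mark_b}})
     {{Mark_a, Mark_c}, {Mark_c, Mark_b}}"

text \<open>The block depends on the split and on whether a 2-join or a complement 2-join is used, hence
  it is a relation between \<open>X\<close> and the resulting trigraph.\<close>

definition block_of_decomposition :: "'a trigraph \<Rightarrow> 'a set \<Rightarrow> 'a block_vertex trigraph \<Rightarrow> bool" where
  "block_of_decomposition T X TX \<longleftrightarrow> (\<exists>A1 B1 C1 A2 B2 C2.
     X = A1 \<union> B1 \<union> C1 \<and> verts T - X = A2 \<union> B2 \<union> C2 \<and>
     (proper_two_join T A1 B1 C1 A2 B2 C2 \<and>
        TX = (if odd_two_join T A1 B1 C1 A2 B2 C2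
              then odd_block T A1 B1 C1 else even_block T A1 B1 C1) \<or>
      proper_complement_two_join T A1 B1 C1 A2 B2 C2 \<and>
        TX = (if odd_two_join (complement T) A1 B1 C1 A2 B2 C2
              then odd_complement_block T A1 B1 C1 else even_complement_block T A1 B1 C1)))"

end

theory Submission
  imports Defs
begin

text \<open>Complementing \<open>T\<close> exchanges 2-joins with complement 2-joins and the corresponding blocks, so
  only blocks of 2-joins matter.

  In a block, a hole or antihole that avoids \<open>c\<close> and does not contain both \<open>a\<close> and \<open>b\<close> becomes one
  of \<open>T\<close> when \<open>a\<close> is replaced by a vertex of \<open>A\<^sub>2\<close> or \<open>b\<close> by a vertex of \<open>B\<^sub>2\<close>. A hole through \<open>a\<close>
  and \<open>b\<close> is cut by its markers into paths from \<open>A\<^sub>1\<close> to \<open>B\<^sub>1\<close> with interior in \<open>C\<^sub>1\<close>. Joining such a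
  path with one on the other side gives a hole of \<open>T\<close>, so the lengths of all of them have the parity
  of the 2-join, and the hole is even. An antihole of length 5 is a hole. In an antihole of length
  at least 7 every vertex has more than two neighbours and any two vertices have a common neighbour,
  so it contains neither \<open>c\<close> nor both of \<open>a\<close> and \<open>b\<close>.

  A vertex of \<open>X\<^sub>1\<close> is not complete to \<open>X\<^sub>2\<close>, so a vertex of degree two in the graph of switchable
  pairs is strongly anticomplete to the rest, which puts it in \<open>C\<^sub>1\<close>, away from the markers.\<close>

section \<open>Symmetry of the adjacency relations and the effect of complementing\<close>

lemma adjacent_sym: "adjacent T u v \<longleftrightarrow> adjacent T v u"
  by (auto simp: adjacent_def vertex_pair_def insert_commute)

lemma antiadjacent_sym: "antiadjacent T u v \<longleftrightarrow> antiadjacent T v u"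
  by (auto simp: antiadjacent_def vertex_pair_def insert_commute)

lemma adjacent_verts: "adjacent T u v \<Longrightarrow> u \<in> verts T \<and> v \<in> verts T \<and> u \<noteq> v"
  by (simp add: adjacent_def vertex_pair_def)

lemma switchable_sym: "switchable T u v \<longleftrightarrow> switchable T v u"
  by (auto simp: switchable_def vertex_pair_def insert_commute)

lemma theta_values:
  assumes "trigraph T" "vertex_pair T u v"
  shows "theta T {u, v} \<in> {-1, 0, 1}"
  using assms by (auto simp: trigraph_def vertex_pair_def)

lemma verts_complement [simp]: "verts (complement T) = verts T"
  by (simp add: complement_def)

lemma theta_complement [simp]: "theta (complement T) e = - theta T e"
  by (simp add: complement_def)

lemma vertex_pair_complement [simp]: "vertex_pair (complement T) = vertex_pair T"
  by (simp add: fun_eq_iff vertex_pair_def)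

lemma adjacent_complement [simp]: "adjacent (complement T) = antiadjacent T"
  by (auto simp: fun_eq_iff adjacent_def antiadjacent_def vertex_pair_def)

lemma antiadjacent_complement [simp]: "antiadjacent (complement T) = adjacent T"
  by (auto simp: fun_eq_iff adjacent_def antiadjacent_def vertex_pair_def)


section \<open>Paths and holes as lists\<close>

lemma path_Nil [simp]: "\<not> path T []"
  by (simp add: path_def)

lemma path_single [simp]: "path T [x] \<longleftrightarrow> x \<in> verts T"
  by (auto simp: path_def)

lemma path_nth:
  "path T p \<Longrightarrow> i < j \<Longrightarrow> j < length p \<Longrightarrow>
     if j - i = 1 then adjacent T (p ! i) (p ! j) else antiadjacent T (p ! i) (p ! j)"
  unfolding path_def by blast

text \<open>Replaces positions by a recursion on the list, so that later facts on paths are list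
  inductions. Distinctness of \<open>x\<close> from the rest is implicit on the right-hand side,
  because adjacent and antiadjacent vertices are always distinct.\<close>

lemma path_Cons [simp]:
  "path T (x # y # p) \<longleftrightarrow>
     adjacent T x y \<and> (\<forall>z\<in>set p. antiadjacent T x z) \<and> path T (y # p)" (is "?L \<longleftrightarrow> ?R")
proof
  note nth_Cons_pos [simp del]
  assume L: ?L
  have ij: "if j - i = 1 then adjacent T ((x # y # p) ! i) ((x # y # p) ! j)
            else antiadjacent T ((x # y # p) ! i) ((x # y # p) ! j)"
    if "i < j" "j < length (x # y # p)" for i j
    using L that unfolding path_def by blast
  have "antiadjacent T x z" if "z \<in> set p" for z
  proof -
    from that obtain k where "k < length p" "p ! k = z" by (auto simp: in_set_conv_nth)
    then show ?thesis using ij[of 0 "Suc (Suc k)"] by auto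
  qed
  moreover have "if j - i = 1 then adjacent T ((y # p) ! i) ((y # p) ! j)
            else antiadjacent T ((y # p) ! i) ((y # p) ! j)"
    if "i < j" "j < length (y # p)" for i j
    using ij[of "Suc i" "Suc j"] that unfolding nth_Cons_Suc diff_Suc_Suc
    by simp
  then have "path T (y # p)"
    using L unfolding path_def by (simp split del: if_split) blast
  ultimately show ?R using ij[of 0 1] by auto
next
  note nth_Cons_pos [simp del]
  assume R: ?R
  have "if j - i = 1 then adjacent T ((x # y # p) ! i) ((x # y # p) ! j)
            else antiadjacent T ((x # y # p) ! i) ((x # y # p) ! j)"
    if ij: "i < j" "j < length (x # y # p)" for i j
  proof (cases i)
    case 0
    then show ?thesis using R ij by (cases "j = 1") (auto simp: nth_Cons split: nat.splits)
  next
    case (Suc k)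
    then obtain l where l: "j = Suc l" "k < l" using ij by (cases j) auto
    have "if l - k = 1 then adjacent T ((y # p) ! k) ((y # p) ! l)
          else antiadjacent T ((y # p) ! k) ((y # p) ! l)"
      using R ij l by (intro path_nth) auto
    then show ?thesis using l Suc by simp
  qed
  moreover have "x \<notin> set (y # p)" "x \<in> verts T"
    using R by (auto simp: adjacent_def antiadjacent_def vertex_pair_def)
  ultimately show ?L
    using R unfolding path_def by (simp split del: if_split) blast
qed

text \<open>Across the cut only the last vertex of \<open>xs\<close> and the first of
  \<open>ys\<close> are consecutive; all other pairs must be antiadjacent. These are grouped by
  whether the left vertex is \<open>last xs\<close>.\<close>

lemma path_append:
  assumes "xs \<noteq> []" "ys \<noteq> []"
  shows "path T (xs @ ys) \<longleftrightarrow> path T xs \<and> path T ys \<and> adjacent T (last xs) (hd ys) \<and>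
    (\<forall>x\<in>set (butlast xs). \<forall>y\<in>set ys. antiadjacent T x y) \<and>
    (\<forall>y\<in>set (tl ys). antiadjacent T (last xs) y)"
  using assms(1)
proof (induction xs rule: list_nonempty_induct)
  case (single x)
  then show ?case using assms(2) by (cases ys) (auto simp: adjacent_def vertex_pair_def)
next
  case (cons x xs)
  then obtain y zs where "xs = y # zs" by (cases xs) auto
  then show ?case using cons by auto
qed

lemma path_rev: "path T p \<Longrightarrow> path T (rev p)"
proof (induction p rule: induct_list012)
  case (3 x y p)
  then have "path T (rev (y # p))" by simp
  moreover have "path T [x]" using 3 by (auto simp: adjacent_def vertex_pair_def)
  moreover have "\<forall>z\<in>set (rev p). antiadjacent T z x" using 3 by (auto simp: antiadjacent_sym)
  ultimately show ?case using 3 path_append[of "rev (y # p)" "[x]" T]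
    by (simp add: adjacent_sym)
qed auto

lemma interior_Cons: "p \<noteq> [] \<Longrightarrow> interior (x # p) = set (butlast p)"
  by (simp add: interior_def)

lemma interior_conv_nth: "interior p = {p ! k |k. 0 < k \<and> k < length p - 1}"
proof -
  have "interior p = {butlast (tl p) ! k |k. k < length p - 2}"
    by (auto simp: interior_def set_conv_nth diff_diff_add numeral_2_eq_2)
  also have "\<dots> = {p ! Suc k |k. k < length p - 2}"
  proof -
    have "butlast (tl p) ! k = p ! Suc k" if "k < length p - 2" for k
      using that by (simp add: nth_butlast nth_tl)
    then show ?thesis by metis
  qed
  also have "\<dots> = {p ! k |k. 0 < k \<and> k < length p - 1}"
  proof (intro set_eqI iffI)
    fix z assume "z \<in> {p ! k |k. 0 < k \<and> k < length p - 1}"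
    then obtain k where "z = p ! k" "0 < k" "k < length p - 1" by auto
    then have "z = p ! Suc (k - 1)" "k - 1 < length p - 2" by auto
    then show "z \<in> {p ! Suc k |k. k < length p - 2}" by blast
  next
    fix z assume "z \<in> {p ! Suc k |k. k < length p - 2}"
    then obtain k where "z = p ! Suc k" "k < length p - 2" by auto
    then show "z \<in> {p ! k |k. 0 < k \<and> k < length p - 1}" by fastforce
  qed
  finally show ?thesis .
qed

lemma interior_rev [simp]: "interior (rev p) = interior p"
  by (metis butlast_rev butlast_tl interior_def rev_rev_ident set_rev)

lemma interior_map: "interior (map f p) = f ` interior p"
  by (metis interior_def image_set map_butlast map_tl)

lemma interior_subset: "interior p \<subseteq> set p"
  by (cases p) (auto simp: interior_def dest: in_set_butlastD)

text \<open>In \<open>v # p\<close> the cyclic distance \<open>length p\<close> occurs only between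
  \<open>v\<close> and the last vertex of \<open>p\<close>. Hence a hole is a path closed up by one
  more vertex, and facts about paths carry over.\<close>

lemma hole_Cons:
  "hole T (v # p) \<longleftrightarrow> 3 \<le> length p \<and> path T p \<and> adjacent T v (hd p) \<and> adjacent T v (last p) \<and>
     (\<forall>z\<in>interior p. antiadjacent T v z)" (is "?L \<longleftrightarrow> ?R")
proof
  note nth_Cons_pos [simp del]
  assume L: ?L
  have ij: "if j - i \<in> {1, length p} then adjacent T ((v # p) ! i) ((v # p) ! j)
            else antiadjacent T ((v # p) ! i) ((v # p) ! j)"
    if "i < j" "j < length (v # p)" for i j
    using L that unfolding hole_def by simp
  have len: "3 \<le> length p" using L by (simp add: hole_def)
  then have "p \<noteq> []" by auto
  have "if j - i = 1 then adjacent T (p ! i) (p ! j) else antiadjacent T (p ! i) (p ! j)"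
    if "i < j" "j < length p" for i j
    using ij[of "Suc i" "Suc j"] that by (auto split: if_splits)
  then have "path T p" using L \<open>p \<noteq> []\<close> by (auto simp: hole_def path_def)
  moreover have "adjacent T v (hd p)" using ij[of 0 1] \<open>p \<noteq> []\<close> by (simp add: hd_conv_nth)
  moreover have "adjacent T v (last p)"
    using ij[of 0 "length p"] \<open>p \<noteq> []\<close> by (simp add: last_conv_nth nth_Cons')
  moreover have "antiadjacent T v z" if "z \<in> interior p" for z
  proof -
    from that obtain k where k: "z = p ! k" "0 < k" "k < length p - 1"
      by (auto simp: interior_conv_nth)
    then have "Suc k < length (v # p)" "Suc k \<noteq> length p" by auto
    then show ?thesis using ij[of 0 "Suc k"] k by (simp split: if_splits)
  qed
  ultimately show ?R using len by blast
next
  note nth_Cons_pos [simp del]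
  assume R: ?R
  then have "p \<noteq> []" by auto
  have hd: "hd p = p ! 0" and last: "last p = p ! (length p - 1)"
    using \<open>p \<noteq> []\<close> by (auto simp: hd_conv_nth last_conv_nth)
  have v: "if k = 0 \<or> k = length p - 1 then adjacent T v (p ! k) else antiadjacent T v (p ! k)"
    if "k < length p" for k
  proof (cases "k = 0 \<or> k = length p - 1")
    case True
    then show ?thesis using R hd last by auto
  next
    case False
    then have "p ! k \<in> interior p" using that by (auto simp: interior_conv_nth)
    then show ?thesis using R False by auto
  qed
  have "if j - i \<in> {1, length p} then adjacent T ((v # p) ! i) ((v # p) ! j)
            else antiadjacent T ((v # p) ! i) ((v # p) ! j)"
    if "i < j" "j < length (v # p)" for i j
  proof -
    from that obtain l where l: "j = Suc l" "l < length p" by (cases j) auto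
    show ?thesis
    proof (cases i)
      case 0
      then show ?thesis using v[of l] l by (auto split: if_splits)
    next
      case (Suc k)
      then have "k < l" using l that by simp
      then have "if l - k = 1 then adjacent T (p ! k) (p ! l) else antiadjacent T (p ! k) (p ! l)"
        using R l by (intro path_nth) auto
      then show ?thesis using l Suc by simp
    qed
  qed
  moreover have "v \<noteq> p ! k" if "k < length p" for k
    using v[OF that] by (auto simp: adjacent_def antiadjacent_def vertex_pair_def split: if_splits)
  then have "v \<notin> set p" by (auto simp: in_set_conv_nth)
  moreover have "v \<in> verts T" using R by (auto simp: adjacent_def vertex_pair_def)
  ultimately show ?L
    using R unfolding hole_def path_def by (simp split del: if_split) blast
qed

lemma hole_rev_tl: "hole T (v # p) \<Longrightarrow> hole T (v # rev p)"
  by (auto simp: hole_Cons path_rev hd_rev last_rev)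

lemma hole_rotate1:
  assumes "hole T h"
  shows "hole T (rotate1 h)"
proof (cases h)
  case (Cons x p)
  with assms have "3 \<le> length p" by (simp add: hole_Cons)
  then obtain y q where p: "p = y # q" "2 \<le> length q" by (cases p) auto
  then obtain z r where q: "q = z # r" "1 \<le> length r" by (cases q) auto
  \<comment> \<open>The old closing vertex \<open>x\<close> becomes the end of the path, and
    \<open>y\<close> takes over as the closing vertex.\<close>
  have "path T (q @ [x])"
    using assms p q Cons path_append[of q "[x]" T]
    by (auto simp: hole_Cons interior_Cons adjacent_sym antiadjacent_sym
        adjacent_def[of T x] vertex_pair_def last_ConsR split: if_splits)
  moreover have "interior (q @ [x]) = set r" using q by (simp add: interior_def)
  ultimately have "hole T (y # q @ [x])"
    using assms p q Cons by (auto simp: hole_Cons adjacent_sym)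
  then show ?thesis using Cons p by simp
qed (use assms in \<open>simp add: hole_def\<close>)

lemma hole_starting_at:
  assumes "hole T h" "v \<in> set h"
  obtains p where "hole T (v # p)" "set (v # p) = set h" "length (v # p) = length h"
proof -
  obtain xs ys where h: "h = xs @ v # ys" using assms(2) by (auto simp: in_set_conv_decomp)
  have "hole T (rotate n h)" for n
    by (induction n) (auto simp: assms(1) hole_rotate1)
  from this[of "length xs"] have "hole T (v # ys @ xs)" by (simp add: h rotate_append)
  then show thesis using that[of "ys @ xs"] h by auto
qed

text \<open>Two paths, each with distinct ends, are glued at both junctions. The proof removes the
  first vertex of \<open>p\<close>, joins the remainder with \<open>q\<close> to a path and closes
  it by that vertex.\<close>

lemma hole_append:
  assumes "path T p" "path T q" "2 \<le> length p" "2 \<le> length q"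
    and "adjacent T (hd p) (last q)" "adjacent T (last p) (hd q)"
    and anti: "\<And>x y. x \<in> set p \<Longrightarrow> y \<in> set q \<Longrightarrow> \<not> (x = hd p \<and> y = last q) \<Longrightarrow>
       \<not> (x = last p \<and> y = hd q) \<Longrightarrow> antiadjacent T x y"
  shows "hole T (p @ q)"
proof -
  obtain x p' where p: "p = x # p'" "p' \<noteq> []" using assms(3) by (cases p) (auto simp: Suc_le_eq)
  obtain y q' where q: "q = y # q'" "q' \<noteq> []" using assms(4) by (cases q) (auto simp: Suc_le_eq)
  obtain a r where r: "p' = a # r" using p by (cases p') auto
  have dist: "x \<notin> set p'" "last p' \<notin> set (butlast p')" "y \<notin> set q'"
    using assms(1,2) p q distinct_append[of "butlast p'" "[last p']"]
    by (auto simp: path_def)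
  have "antiadjacent T u v" if "u \<in> set (butlast p')" "v \<in> set q" for u v
    using that dist p in_set_butlastD[OF that(1)] by (intro anti) auto
  moreover have "antiadjacent T (last p') v" if "v \<in> set q'" for v
    using that dist p q last_in_set[of p'] by (intro anti) auto
  ultimately have "path T (p' @ q)"
    using path_append[of p' q T] p q r assms(1,2,6) by auto
  moreover have "interior (p' @ q) = set r \<union> set (butlast q)"
    using r q by (simp add: interior_def butlast_append)
  moreover have "antiadjacent T x v" if "v \<in> set (butlast q)" for v
  proof -
    have "last q \<notin> set (butlast q)"
      using assms(2) q distinct_append[of "butlast q" "[last q]"] by (auto simp: path_def)
    then show ?thesis using that dist p in_set_butlastD[OF that] last_in_set[of p']
      by (intro anti) auto
  qed
  ultimately show ?thesis using assms p q r by (auto simp: hole_Cons Suc_le_eq)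
qed

text \<open>The cycle of length 5 is isomorphic to its complement.\<close>

lemma hole_of_antihole_5:
  assumes "antihole T h" "length h = 5"
  obtains h' where "hole T h'" "length h' = 5"
proof -
  obtain a b c d e where h: "h = [a, b, c, d, e]"
    using assms(2) by (auto simp: numeral_eq_Suc length_Suc_conv)
  \<comment> \<open>Steps of two around the antihole run through the pairs that are nonconsecutive
    in it, which are adjacent in \<open>T\<close>.\<close>
  have "hole T [a, c, e, b, d]"
    using assms(1) unfolding h antihole_def
    by (auto simp: hole_Cons interior_def adjacent_sym antiadjacent_sym dest: adjacent_verts)
  then show thesis using that by auto
qed

text \<open>Injectivity of \<open>f\<close> on the path is automatic: two vertices of a path are
  adjacent or antiadjacent, so the same holds for their images, which are therefore
  distinct.\<close>

lemma path_map:
  assumes "path T p"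
    and "\<And>u v. u \<in> set p \<Longrightarrow> v \<in> set p \<Longrightarrow> adjacent T u v \<Longrightarrow> adjacent T' (f u) (f v)"
    and "\<And>u v. u \<in> set p \<Longrightarrow> v \<in> set p \<Longrightarrow> antiadjacent T u v \<Longrightarrow> antiadjacent T' (f u) (f v)"
    and "f ` set p \<subseteq> verts T'"
  shows "path T' (map f p)"
  using assms by (induction p rule: induct_list012) auto

lemma hole_map:
  assumes h: "hole T h"
    and adj: "\<And>u v. u \<in> set h \<Longrightarrow> v \<in> set h \<Longrightarrow> adjacent T u v \<Longrightarrow> adjacent T' (f u) (f v)"
    and anti: "\<And>u v. u \<in> set h \<Longrightarrow> v \<in> set h \<Longrightarrow> antiadjacent T u v \<Longrightarrow>
      antiadjacent T' (f u) (f v)"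
    and verts: "f ` set h \<subseteq> verts T'"
  shows "hole T' (map f h)"
proof (cases h)
  case (Cons v p)
  then have "p \<noteq> []" using h by (auto simp: hole_def)
  moreover have "path T' (map f p)"
    using h Cons by (intro path_map[of T p]) (use adj anti verts in \<open>auto simp: hole_Cons\<close>)
  ultimately show ?thesis
    using h Cons \<open>p \<noteq> []\<close> adj anti interior_subset[of p]
    by (auto simp: hole_Cons hd_map last_map interior_map)
qed (use h in \<open>simp add: hole_def\<close>)


section \<open>Side paths\<close>

lemma vertex_in_component:
  assumes "finite (verts T)" "v \<in> verts T"
  obtains Y where "component T Y" "v \<in> Y"
proof -
  let ?S = "{Y. v \<in> Y \<and> Y \<subseteq> verts T \<and> connected T Y}"
  have "finite ?S" using assms(1) by (auto intro: finite_subset[of _ "Pow (verts T)"])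
  moreover have "{v} \<in> ?S" using assms(2) by (auto simp: connected_def graph_connected_def)
  ultimately obtain Y where "Y \<in> ?S" and max: "\<forall>Z\<in>?S. Y \<subseteq> Z \<longrightarrow> Y = Z"
    using finite_has_maximal2[of ?S "{v}"] by blast
  then have "component T Y" unfolding component_def by blast
  then show thesis using that \<open>Y \<in> ?S\<close> by blast
qed

lemma rtranclp_successively:
  assumes "R\<^sup>*\<^sup>* x y"
  obtains w where "w \<noteq> []" "hd w = x" "last w = y" "successively R w"
  using assms
proof (induction arbitrary: thesis rule: rtranclp_induct)
  case base
  show ?case by (rule base[of "[x]"]) auto
next
  case (step y z)
  obtain w where "w \<noteq> []" "hd w = x" "last w = y" "successively R w" by (rule step.IH)
  then show ?case using step.hyps(2)
    by (intro step.prems[of "w @ [z]"]) (auto simp: successively_append_iff)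
qed

text \<open>A component that meets both \<open>A\<close> and \<open>B\<close> contains a walk
  between them. A shortest such walk within the side has no chords and meets \<open>A\<close> and
  \<open>B\<close> only at its ends.\<close>

lemma side_path_exists:
  assumes T: "trigraph T" and sub: "A \<union> B \<union> C \<subseteq> verts T"
    and proper: "proper_side T A B C" and "A \<noteq> {}"
  obtains p where "side_path T A B C p"
proof -
  let ?X = "A \<union> B \<union> C"
  define walk where "walk w \<longleftrightarrow> w \<noteq> [] \<and> set w \<subseteq> ?X \<and> successively (adjacent T) w \<and>
     hd w \<in> A \<and> last w \<in> B" for w
  obtain a where a: "a \<in> A" using \<open>A \<noteq> {}\<close> by blast
  have "finite ?X" using T sub by (auto simp: trigraph_def intro: finite_subset)
  then obtain Y where Y: "component (induced T ?X) Y" "a \<in> Y"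
    using vertex_in_component[of "induced T ?X" a] a by (auto simp: induced_def)
  then obtain b where b: "b \<in> Y" "b \<in> B" using proper by (auto simp: proper_side_def)
  let ?R = "\<lambda>x y. x \<in> Y \<and> y \<in> Y \<and> adjacent (induced (induced T ?X) Y) x y"
  have "?R\<^sup>*\<^sup>* a b"
    using Y b by (auto simp: component_def connected_def graph_connected_def)
  then obtain w where w: "w \<noteq> []" "hd w = a" "last w = b" "successively ?R w"
    by (rule rtranclp_successively)
  have YX: "Y \<subseteq> ?X" using Y by (auto simp: component_def induced_def)
  have R: "adjacent T x y" if "?R x y" for x y
    using that YX sub by (auto simp: adjacent_def induced_def vertex_pair_def)
  have "set w \<subseteq> Y"
  proof -
    have "successively ?R w \<Longrightarrow> hd w \<in> Y \<Longrightarrow> set w \<subseteq> Y" for w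
      by (induction w rule: induct_list012) auto
    then show ?thesis using w Y by blast
  qed
  moreover have "successively (adjacent T) w"
    using w(4) by (rule successively_mono) (use R in auto)
  ultimately have "walk w" using w a b YX by (auto simp: walk_def)
  then obtain p where p: "walk p" and min: "\<And>q. walk q \<Longrightarrow> length p \<le> length q"
    using ex_has_least_nat[of walk w length] by blast
  \<comment> \<open>Each violation would give a shorter walk: merge \<open>x\<close> with
    \<open>y\<close>, jump from \<open>x\<close> to \<open>y\<close>, start at \<open>y\<close>, or
    stop at \<open>x\<close>.\<close>
  have shortcut: "x \<noteq> y" "ys \<noteq> [] \<Longrightarrow> \<not> adjacent T x y" "y \<notin> A" "x \<notin> B"
    if eq: "p = xs @ x # ys @ y # zs" for xs x ys y zs
  proof -
    have "\<not> walk q" if "length q < length p" for q using min[of q] that by auto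
    then have "\<not> walk (xs @ y # zs)" "ys \<noteq> [] \<Longrightarrow> \<not> walk (xs @ x # y # zs)"
      "\<not> walk (y # zs)" "\<not> walk (xs @ [x])" by (auto simp: eq)
    then show "x \<noteq> y" "ys \<noteq> [] \<Longrightarrow> \<not> adjacent T x y" "y \<notin> A" "x \<notin> B"
      using p by (auto simp: eq walk_def successively_append_iff successively_Cons hd_append
          split: if_splits)
  qed
  \<comment> \<open>Induction over the suffixes of the shortest walk; the discarded prefix
    \<open>xs\<close> keeps the suffix tied to \<open>p\<close>, so that minimality still
    applies.\<close>
  have "path T qs" if "p = xs @ qs" "qs \<noteq> []" for xs qs
    using that
  proof (induction qs arbitrary: xs rule: induct_list012)
    case (2 x)
    then show ?case using p sub by (auto simp: walk_def)
  next
    case (3 x y r)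
    have "antiadjacent T x z" if "z \<in> set r" for z
    proof -
      from that obtain r1 r2 where "r = r1 @ z # r2" by (auto simp: in_set_conv_decomp)
      then have "p = xs @ x # (y # r1) @ z # r2" using 3 by simp
      from shortcut(1,2)[OF this] have "x \<noteq> z" "\<not> adjacent T x z" by auto
      moreover have "x \<in> verts T" "z \<in> verts T" using that p 3 sub by (auto simp: walk_def)
      ultimately show ?thesis using theta_values[OF T, of x z]
        by (auto simp: adjacent_def antiadjacent_def vertex_pair_def)
    qed
    moreover have "adjacent T x y" using p 3(3) by (auto simp: walk_def successively_append_iff)
    moreover have "path T (y # r)" using 3(2)[of "xs @ [x]"] 3(3) by simp
    ultimately show ?case by simp
  qed simp
  then have "path T p" using p by (auto simp: walk_def)
  moreover have "interior p \<subseteq> C"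
  proof
    fix z assume z: "z \<in> interior p"
    obtain u p' where p': "p = u # p'" "p' \<noteq> []"
      using z by (cases p) (fastforce simp: interior_def)+
    obtain m1 m2 where "butlast p' = m1 @ z # m2"
      using z p' by (auto simp: interior_def in_set_conv_decomp)
    then have eq: "p = u # m1 @ z # m2 @ [last p']"
      using p' append_butlast_last_id[of p'] by simp
    have "z \<notin> A" using shortcut(3)[of "[]" u m1 z] eq by simp
    moreover have "z \<notin> B" using shortcut(4)[of "u # m1" z m2 "last p'" "[]"] eq by simp
    moreover have "z \<in> ?X" using p eq by (auto simp: walk_def)
    ultimately show "z \<in> C" by blast
  qed
  ultimately show thesis using that p by (auto simp: side_path_def walk_def)
qed

lemma side_path_length:
  assumes "side_path T A B C p" "A \<inter> B = {}"
  shows "2 \<le> length p"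
proof -
  have "p \<noteq> []" "hd p \<noteq> last p" using assms by (auto simp: side_path_def)
  then show ?thesis by (cases p) (auto simp: Suc_le_eq)
qed

lemma side_path_set:
  assumes "side_path T A B C p" "x \<in> set p"
  shows "x = hd p \<or> x = last p \<or> x \<in> C"
proof -
  have "x = hd p \<or> x \<in> set (tl p)" using assms(2) by (cases p) auto
  moreover have "x = last p \<or> x \<in> set (butlast (tl p))" if "x \<in> set (tl p)"
  proof -
    have "tl p \<noteq> []" using that by auto
    then have "last (tl p) = last p" by (simp add: last_tl)
    moreover have "x \<in> set (butlast (tl p) @ [last (tl p)])"
      using that \<open>tl p \<noteq> []\<close> by simp
    ultimately show ?thesis by auto
  qed
  ultimately show ?thesis using assms(1) by (auto simp: side_path_def interior_def)
qed


section \<open>Complements and connectivity\<close>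

text \<open>Negation keeps switchable pairs, exchanges holes with antiholes, and exchanges the two
  alternatives at a vertex of degree two. The values are compared on vertex pairs only, because
  blocks of a 2-join and of a complement 2-join are not negatives of each other elsewhere: at
  \<open>{Mark_a}\<close> both take the value \<open>-1\<close>.\<close>

lemma class_F_complement:
  assumes F: "T \<in> class_F" and verts: "verts T' = verts T"
    and theta: "\<And>u v. vertex_pair T u v \<Longrightarrow> theta T' {u, v} = - theta T {u, v}"
  shows "T' \<in> class_F"
proof -
  have vp: "vertex_pair T' = vertex_pair T"
    by (auto simp: fun_eq_iff vertex_pair_def verts)
  have sw: "switchable T' = switchable T"
    and sa: "strongly_adjacent T' = strongly_antiadjacent T"
    and san: "strongly_antiadjacent T' = strongly_adjacent T"
    and adj: "adjacent T' = antiadjacent T" and anti: "antiadjacent T' = adjacent T"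
    by (auto simp: fun_eq_iff switchable_def strongly_adjacent_def strongly_antiadjacent_def
        adjacent_def antiadjacent_def vp theta)
  have "theta T' e \<in> {-1, 0, 1}" if e: "e \<subseteq> verts T" "card e = 2" for e
  proof -
    obtain u v where uv: "e = {u, v}" "u \<noteq> v" using e(2) by (auto simp: card_2_iff)
    then have "vertex_pair T u v" using e(1) by (auto simp: vertex_pair_def)
    moreover have "theta T e \<in> {-1, 0, 1}" using F e by (auto simp: class_F_def trigraph_def)
    ultimately show ?thesis using theta[of u v] uv by auto
  qed
  then have "trigraph T'" using F by (simp add: class_F_def trigraph_def verts)
  moreover have "hole T' = antihole T" "antihole T' = hole T"
    by (auto simp only: fun_eq_iff antihole_def hole_def adj anti verts verts_complement
        adjacent_complement antiadjacent_complement)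
  then have "Berge T'" using F by (simp add: class_F_def Berge_def)
  moreover have sc: "strongly_complete T' = strongly_anticomplete T"
    "strongly_anticomplete T' = strongly_complete T"
    by (simp_all add: fun_eq_iff strongly_complete_def strongly_anticomplete_def sa san)
  have "(strongly_complete T' {v} (verts T' - {v, x, y}) \<and> strongly_adjacent T' x y) \<or>
        (strongly_anticomplete T' {v} (verts T' - {v, x, y}) \<and> strongly_antiadjacent T' x y)"
    if "v \<in> verts T'" "x \<noteq> y" "{w. switchable T' v w} = {x, y}" for v x y
    using F that unfolding class_F_def sw verts sc sa san mem_Collect_eq by blast
  moreover have "card {{u, v} |u v. u \<in> Y \<and> v \<in> Y \<and> switchable T' u v} \<le> 2"
    if "graph_component (verts T') (switchable T') Y" for Y
    using F that unfolding class_F_def sw verts mem_Collect_eq by blast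
  ultimately show ?thesis unfolding class_F_def by blast
qed

lemma graph_connected_image:
  assumes "graph_connected Z E" "\<And>x y. x \<in> Z \<Longrightarrow> y \<in> Z \<Longrightarrow> E x y \<Longrightarrow> E' (f x) (f y)"
  shows "graph_connected (f ` Z) E'"
proof -
  have "(\<lambda>x y. x \<in> f ` Z \<and> y \<in> f ` Z \<and> E' x y)\<^sup>*\<^sup>* (f u) (f v)"
    if "(\<lambda>x y. x \<in> Z \<and> y \<in> Z \<and> E x y)\<^sup>*\<^sup>* u v" for u v
    using that
  proof (induction rule: rtranclp_induct)
    case (step y z)
    then show ?case using assms(2) by (auto intro: rtranclp.rtrancl_into_rtrancl)
  qed simp
  then show ?thesis using assms(1) by (auto simp: graph_connected_def)
qed

text \<open>Used to confine a connected set of switchable pairs to the markers or to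
  \<open>X1\<close>.\<close>

lemma graph_connected_subset:
  assumes "graph_connected Y E" "u \<in> Y" "u \<in> S" "\<And>x y. x \<in> S \<Longrightarrow> E x y \<Longrightarrow> y \<in> S"
  shows "Y \<subseteq> S"
proof
  fix v assume "v \<in> Y"
  with assms have "(\<lambda>x y. x \<in> Y \<and> y \<in> Y \<and> E x y)\<^sup>*\<^sup>* u v" by (auto simp: graph_connected_def)
  then show "v \<in> S" by (induction rule: rtranclp_induct) (use assms in auto)
qed


section \<open>The block of a 2-join\<close>

text \<open>The value at \<open>Mark_c\<close> is never used.\<close>

fun retract :: "'a \<Rightarrow> 'a \<Rightarrow> 'a block_vertex \<Rightarrow> 'a" where
  "retract a b (Orig u) = u"
| "retract a b Mark_a = a"
| "retract a b Mark_b = b"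
| "retract a b Mark_c = a"

text \<open>Only 2-joins are treated here; a complement 2-join of a trigraph is covered by taking
  its complement for \<open>T\<close>.\<close>

locale two_join_block =
  fixes T :: "'a trigraph" and A1 B1 C1 A2 B2 C2 and TX
  assumes F: "T \<in> class_F"
    and join: "proper_two_join T A1 B1 C1 A2 B2 C2"
    and TX: "TX = (if odd_two_join T A1 B1 C1 A2 B2 C2
              then odd_block T A1 B1 C1 else even_block T A1 B1 C1)"
begin

abbreviation "X1 \<equiv> A1 \<union> B1 \<union> C1"
abbreviation "X2 \<equiv> A2 \<union> B2 \<union> C2"
abbreviation "odd_join \<equiv> odd_two_join T A1 B1 C1 A2 B2 C2"

section \<open>Vertices and adjacency of the block\<close>

lemma trigraph: "trigraph T" and Berge: "Berge T"
  using F by (auto simp: class_F_def)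

lemma verts_T: "verts T = X1 \<union> X2" and disj: "X1 \<inter> X2 = {}"
  and nonempty: "A1 \<noteq> {}" "B1 \<noteq> {}" "A2 \<noteq> {}" "B2 \<noteq> {}"
  and disj1: "A1 \<inter> B1 = {}" "A1 \<inter> C1 = {}" "B1 \<inter> C1 = {}"
  and disj2: "A2 \<inter> B2 = {}" "A2 \<inter> C2 = {}" "B2 \<inter> C2 = {}"
  using join by (auto simp: proper_two_join_def two_join_def two_join_side_def Let_def)

lemma theta_cross:
  assumes "u \<in> X1" "v \<in> X2"
  shows "theta T {u, v} = (if u \<in> A1 \<and> v \<in> A2 \<or> u \<in> B1 \<and> v \<in> B2 then 1 else -1)"
  using join assms
  by (auto simp: proper_two_join_def two_join_def Let_def strongly_complete_def
      strongly_adjacent_def strongly_antiadjacent_def)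

lemma verts_TX: "verts TX = Orig ` X1 \<union> {Mark_a, Mark_b} \<union> (if odd_join then {} else {Mark_c})"
  by (auto simp: TX odd_block_def even_block_def add_markers_def)

lemma theta_Orig: "u \<in> X1 \<Longrightarrow> v \<in> X1 \<Longrightarrow> theta TX {Orig u, Orig v} = theta T {u, v}"
proof -
  assume "u \<in> X1" "v \<in> X1"
  moreover have "Orig -` {Orig u, Orig v} = {u, v}" by auto
  ultimately show ?thesis by (simp add: TX odd_block_def even_block_def add_markers_def)
qed

lemma theta_marker_Orig:
  "theta TX {Mark_a, Orig u} = (if u \<in> A1 then 1 else -1)"
  "theta TX {Mark_b, Orig u} = (if u \<in> B1 then 1 else -1)"
  "theta TX {Mark_c, Orig u} = -1"
  by (auto simp: TX odd_block_def even_block_def add_markers_def star_def doubleton_eq_iff)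

lemma theta_markers:
  "theta TX {Mark_a, Mark_b} = (if odd_join then 0 else -1)"
  "\<not> odd_join \<Longrightarrow> theta TX {Mark_a, Mark_c} = 0"
  "\<not> odd_join \<Longrightarrow> theta TX {Mark_b, Mark_c} = 0"
  by (auto simp: TX odd_block_def even_block_def add_markers_def star_def doubleton_eq_iff)

lemma vertex_pair_TX:
  "vertex_pair TX (Orig u) (Orig v) \<longleftrightarrow> u \<in> X1 \<and> v \<in> X1 \<and> u \<noteq> v"
  "vertex_pair TX Mark_a (Orig u) \<longleftrightarrow> u \<in> X1"
  "vertex_pair TX Mark_b (Orig u) \<longleftrightarrow> u \<in> X1"
  "vertex_pair TX Mark_c (Orig u) \<longleftrightarrow> u \<in> X1 \<and> \<not> odd_join"
  "vertex_pair TX Mark_a Mark_b"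
  "vertex_pair TX Mark_a Mark_c \<longleftrightarrow> \<not> odd_join"
  "vertex_pair TX Mark_b Mark_c \<longleftrightarrow> \<not> odd_join"
  "\<not> vertex_pair TX w w"
  by (auto simp: vertex_pair_def verts_TX)

lemmas theta_TX = theta_Orig theta_marker_Orig theta_markers

lemma vertex_pair_T: "u \<in> X1 \<Longrightarrow> v \<in> X1 \<Longrightarrow> vertex_pair T u v \<longleftrightarrow> u \<noteq> v"
  by (auto simp: vertex_pair_def verts_T)

lemma adjacent_TX:
  "adjacent TX (Orig u) (Orig v) \<longleftrightarrow> u \<in> X1 \<and> v \<in> X1 \<and> adjacent T u v"
  "adjacent TX Mark_a (Orig u) \<longleftrightarrow> u \<in> A1"
  "adjacent TX Mark_b (Orig u) \<longleftrightarrow> u \<in> B1"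
  "adjacent TX Mark_c (Orig u) \<longleftrightarrow> False"
  "adjacent TX Mark_a Mark_b \<longleftrightarrow> odd_join"
  "adjacent TX Mark_a Mark_c \<longleftrightarrow> \<not> odd_join"
  "adjacent TX Mark_b Mark_c \<longleftrightarrow> \<not> odd_join"
  "\<not> adjacent TX w w"
  by (auto simp: adjacent_def vertex_pair_TX theta_TX vertex_pair_T split: if_splits)

lemma antiadjacent_TX:
  "antiadjacent TX (Orig u) (Orig v) \<longleftrightarrow> u \<in> X1 \<and> v \<in> X1 \<and> antiadjacent T u v"
  "antiadjacent TX Mark_a (Orig u) \<longleftrightarrow> u \<in> X1 - A1"
  "antiadjacent TX Mark_b (Orig u) \<longleftrightarrow> u \<in> X1 - B1"
  by (auto simp: antiadjacent_def vertex_pair_TX theta_TX vertex_pair_T split: if_splits)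

lemma switchable_TX:
  "switchable TX (Orig u) (Orig v) \<longleftrightarrow> u \<in> X1 \<and> v \<in> X1 \<and> switchable T u v"
  "switchable TX Mark_a (Orig u) \<longleftrightarrow> False"
  "switchable TX Mark_b (Orig u) \<longleftrightarrow> False"
  "switchable TX Mark_c (Orig u) \<longleftrightarrow> False"
  "switchable TX Mark_a Mark_b \<longleftrightarrow> odd_join"
  "switchable TX Mark_a Mark_c \<longleftrightarrow> \<not> odd_join"
  "switchable TX Mark_b Mark_c \<longleftrightarrow> \<not> odd_join"
  "\<not> switchable TX w w"
  by (auto simp: switchable_def vertex_pair_TX theta_TX vertex_pair_T split: if_splits)

text \<open>The rules composed with symmetry are the same rules with the two vertices
  exchanged.\<close>

lemmas pair_simps [simp] =
  adjacent_TX adjacent_TX(2-7)[THEN trans[OF adjacent_sym]]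
  antiadjacent_TX antiadjacent_TX(2-3)[THEN trans[OF antiadjacent_sym]]
  switchable_TX switchable_TX(2-7)[THEN trans[OF switchable_sym]]

section \<open>Replacing markers by vertices of the other side\<close>

text \<open>A vertex of \<open>A2\<close> is related to \<open>X1\<close> exactly as
  \<open>Mark_a\<close> is, and a vertex of \<open>B2\<close> exactly as \<open>Mark_b\<close> is.
  The pair of both markers is excluded because nothing is known about the pair \<open>a\<close>,
  \<open>b\<close> in \<open>T\<close>.\<close>

lemma retract_pair:
  assumes "a \<in> A2" "b \<in> B2" "vertex_pair TX u v" "u \<noteq> Mark_c" "v \<noteq> Mark_c"
    and "{u, v} \<noteq> {Mark_a, Mark_b}"
  shows "vertex_pair T (retract a b u) (retract a b v) \<and>
    theta T {retract a b u, retract a b v} = theta TX {u, v}"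
proof -
  have cross: "theta T {v, u} = (if u \<in> A1 \<and> v \<in> A2 \<or> u \<in> B1 \<and> v \<in> B2 then 1 else -1)"
    if "u \<in> X1" "v \<in> X2" for u v
    using theta_cross[OF that] by (simp add: insert_commute)
  have TX_sym: "theta TX {Orig x, m} = theta TX {m, Orig x}" for x m
    by (simp add: insert_commute)
  have ab: "a \<in> X2" "b \<in> X2" "a \<notin> X1" "b \<notin> X1" "a \<notin> B2" "b \<notin> A2"
    using assms(1,2) disj disj2 by auto
  show ?thesis
  proof (cases u)
    case (Orig x)
    show ?thesis
    proof (cases v)
      case (Orig y)
      then show ?thesis using assms(3) \<open>u = Orig x\<close>
        by (simp add: vertex_pair_TX vertex_pair_T theta_Orig)
    qed (use Orig assms ab in \<open>auto simp: vertex_pair_def verts_TX verts_T theta_cross TX_sym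
        theta_marker_Orig split: if_splits\<close>)
  next
    case Mark_a
    then show ?thesis using assms ab
      by (cases v) (auto simp: vertex_pair_def verts_TX verts_T cross theta_marker_Orig
          split: if_splits)
  next
    case Mark_b
    then show ?thesis using assms ab
      by (cases v) (auto simp: vertex_pair_def verts_TX verts_T cross theta_marker_Orig
          split: if_splits)
  qed (use assms in auto)
qed

text \<open>Treats holes and antiholes at once: \<open>S\<close> and \<open>S'\<close> are either
  the block and \<open>T\<close>, or their complements.\<close>

lemma retract_hole:
  assumes "hole S h" "S = TX \<and> S' = T \<or> S = complement TX \<and> S' = complement T"
    and "Mark_c \<notin> set h" "\<not> {Mark_a, Mark_b} \<subseteq> set h"
  obtains h' where "hole S' h'" "length h' = length h"
proof -
  obtain a b where ab: "a \<in> A2" "b \<in> B2" using nonempty by blast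
  have pair: "vertex_pair T (retract a b u) (retract a b v) \<and>
      theta T {retract a b u, retract a b v} = theta TX {u, v}"
    if "u \<in> set h" "v \<in> set h" "vertex_pair TX u v" for u v
    using that assms(3,4) ab by (intro retract_pair) (auto simp: doubleton_eq_iff)
  have "adjacent S' (retract a b u) (retract a b v)"
    if "u \<in> set h" "v \<in> set h" "adjacent S u v" for u v
    using assms(2) that pair[OF that(1,2)] by (auto simp: adjacent_def antiadjacent_def)
  moreover have "antiadjacent S' (retract a b u) (retract a b v)"
    if "u \<in> set h" "v \<in> set h" "antiadjacent S u v" for u v
    using assms(2) that pair[OF that(1,2)] by (auto simp: adjacent_def antiadjacent_def)
  moreover have "retract a b ` set h \<subseteq> verts S'"
  proof -
    have "set h \<subseteq> verts TX" using assms(1,2) by (auto simp: hole_def)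
    then show ?thesis using ab assms(2,3) by (auto simp: verts_TX verts_T split: if_splits)
  qed
  ultimately have "hole S' (map (retract a b) h)" using assms(1) by (intro hole_map)
  then show thesis using that by auto
qed

section \<open>Parity of side paths\<close>

text \<open>The list \<open>p @ rev q\<close> is a hole of \<open>T\<close>: the only adjacent pairs
  across the 2-join are the two junctions, since interior vertices lie in \<open>C1\<close> or
  \<open>C2\<close>. Its length is even because \<open>T\<close> is Berge.\<close>

lemma side_paths_same_parity:
  assumes p: "side_path T A1 B1 C1 p" and q: "side_path T A2 B2 C2 q"
  shows "even (length p + length q)"
proof -
  have ends: "hd p \<in> A1" "last p \<in> B1" "hd q \<in> A2" "last q \<in> B2"
    using p q by (auto simp: side_path_def)
  have cross: "adjacent T x y \<longleftrightarrow> x \<in> A1 \<and> y \<in> A2 \<or> x \<in> B1 \<and> y \<in> B2"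
    "antiadjacent T x y \<longleftrightarrow> \<not> (x \<in> A1 \<and> y \<in> A2 \<or> x \<in> B1 \<and> y \<in> B2)"
    if "x \<in> X1" "y \<in> X2" for x y
    using that disj theta_cross[OF that]
    by (auto simp: adjacent_def antiadjacent_def vertex_pair_def verts_T)
  have "hole T (p @ rev q)"
  proof (rule hole_append)
    show "path T p" "path T (rev q)" using p q by (auto simp: side_path_def path_rev)
    show "2 \<le> length p" "2 \<le> length (rev q)" using p q disj1 disj2 by (auto dest: side_path_length)
    show "adjacent T (hd p) (last (rev q))" "adjacent T (last p) (hd (rev q))"
      using ends by (auto simp: cross last_rev hd_rev)
  next
    fix x y
    assume "x \<in> set p" "y \<in> set (rev q)" "\<not> (x = hd p \<and> y = last (rev q))"
      "\<not> (x = last p \<and> y = hd (rev q))"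
    then show "antiadjacent T x y"
      using side_path_set[OF p, of x] side_path_set[OF q, of y] ends disj1 disj2
      by (subst cross) (auto simp: last_rev hd_rev)
  qed
  then show ?thesis using Berge by (auto simp: Berge_def)
qed

lemma side_path_parity:
  assumes "side_path T A1 B1 C1 p"
  shows "even (length p) \<longleftrightarrow> odd_join"
proof -
  \<comment> \<open>A path on the second side is needed to compare two paths of the first side with
    each other.\<close>
  obtain q where q: "side_path T A2 B2 C2 q"
    using side_path_exists[of T A2 B2 C2] trigraph join nonempty verts_T
    by (auto simp: proper_two_join_def)
  \<comment> \<open>The length counts edges, one less than the number of vertices, so in an odd
    2-join side paths have an even number of vertices.\<close>
  have len: "odd (path_length r) \<longleftrightarrow> even (length r)"
    if "side_path T A1 B1 C1 r \<or> side_path T A2 B2 C2 r" for r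
    using that disj1 disj2 by (auto simp: path_length_def dest: side_path_length)
  have "even (length r) \<longleftrightarrow> even (length p)"
    if "side_path T A1 B1 C1 r \<or> side_path T A2 B2 C2 r" for r
    using that side_paths_same_parity[OF assms] side_paths_same_parity[OF _ q] assms q
    by (metis even_add)
  then show ?thesis unfolding odd_two_join_def using len assms by blast
qed

section \<open>Holes of the block\<close>

text \<open>Adjacency to \<open>Mark_a\<close> means membership in \<open>A1\<close>, and adjacency
  to \<open>Mark_b\<close> means membership in \<open>B1\<close>. So \<open>p\<close> is the copy of
  a side path of \<open>T\<close>.\<close>

lemma marker_path_parity:
  assumes "path TX p" "set p \<subseteq> Orig ` X1" "adjacent TX Mark_a (hd p)" "adjacent TX Mark_b (last p)"
    and "\<And>z. z \<in> interior p \<Longrightarrow> antiadjacent TX Mark_a z \<and> antiadjacent TX Mark_b z"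
  shows "even (length p) \<longleftrightarrow> odd_join"
proof -
  obtain q where p: "p = map Orig q" using assms(2) ex_map_conv[of p Orig] by auto
  have "q \<noteq> []" using assms(1) p by auto
  \<comment> \<open>The images of the markers are arbitrary, since no marker lies on
    \<open>p\<close>.\<close>
  have "path T (map (retract undefined undefined) p)"
    using assms(2) by (intro path_map[OF assms(1)]) (auto simp: p verts_T)
  then have "path T q" by (simp add: p comp_def)
  moreover have "hd q \<in> A1" "last q \<in> B1" using assms(3,4) p \<open>q \<noteq> []\<close> by (auto simp: hd_map last_map)
  moreover have "interior q \<subseteq> C1"
    using assms(5) unfolding p interior_map by fastforce
  ultimately show ?thesis using side_path_parity[of q] p by (simp add: side_path_def)
qed

text \<open>An arc of a hole between the two markers has its ends adjacent to them and its interior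
  antiadjacent to both.\<close>

lemma marker_segment_parity:
  assumes h: "hole TX (Mark_a # P @ Mark_b # Q)" and "P \<noteq> []" "Mark_c \<notin> set P"
  shows "even (length P) \<longleftrightarrow> odd_join"
proof (rule marker_path_parity)
  have path: "path TX (P @ Mark_b # Q)" and a: "adjacent TX Mark_a (hd P)"
    and int: "\<And>z. z \<in> interior (P @ Mark_b # Q) \<Longrightarrow> antiadjacent TX Mark_a z"
    using h \<open>P \<noteq> []\<close> by (auto simp: hole_Cons)
  note split = path_append[THEN iffD1, OF \<open>P \<noteq> []\<close> _ path, simplified]
  show "path TX P" "adjacent TX Mark_a (hd P)" "adjacent TX Mark_b (last P)"
    using split a adjacent_sym[of TX "last P"] by auto
  have "distinct (Mark_a # P @ Mark_b # Q)" "set P \<subseteq> verts TX" using h by (auto simp: hole_def)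
  then show "set P \<subseteq> Orig ` X1" using \<open>Mark_c \<notin> set P\<close> by (auto simp: verts_TX split: if_splits)
  fix z assume z: "z \<in> interior P"
  then have "z \<in> interior (P @ Mark_b # Q)"
    using \<open>P \<noteq> []\<close> by (auto simp: interior_def butlast_append dest: in_set_butlastD)
  moreover have "z \<in> set (butlast P)"
    using z by (cases P) (auto simp: interior_def split: if_splits)
  ultimately show "antiadjacent TX Mark_a z \<and> antiadjacent TX Mark_b z"
    using int split antiadjacent_sym[of TX z] by auto
qed

lemma adjacent_Mark_c: "adjacent TX Mark_c z \<Longrightarrow> z = Mark_a \<or> z = Mark_b"
  by (cases z) auto

lemma hole_even:
  assumes "hole TX h"
  shows "even (length h)"
proof (cases "Mark_c \<in> set h")
  case True
  \<comment> \<open>The neighbours of \<open>Mark_c\<close> on the hole can only be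
    \<open>Mark_a\<close> and \<open>Mark_b\<close>; reversal fixes their order. As the 2-join is
    even, the remaining arc \<open>Q\<close> has an odd number of vertices, and the three markers
    make the total even.\<close>
  have *: "odd (length Q)" if c: "hole TX (Mark_c # Mark_a # Q @ [Mark_b])" for Q
  proof -
    have "\<not> odd_join" "Q \<noteq> []" using c by (auto simp: hole_Cons)
    moreover have "Mark_c \<notin> set Q" using c by (auto simp: hole_def)
    moreover have "hole TX (Mark_a # Q @ Mark_b # [Mark_c])" using hole_rotate1[OF c] by simp
    ultimately show ?thesis using marker_segment_parity by blast
  qed
  obtain p where p: "hole TX (Mark_c # p)" "length (Mark_c # p) = length h"
    using hole_starting_at[OF assms True] by metis
  then obtain u q where u: "p = u # q" by (cases p) (auto simp: hole_Cons)
  with p obtain Q v where q: "q = Q @ [v]" by (cases q rule: rev_cases) (auto simp: hole_Cons)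
  have "u \<noteq> v" using p u q by (auto simp: hole_def)
  moreover have "u = Mark_a \<or> u = Mark_b" "v = Mark_a \<or> v = Mark_b"
    using p u q by (auto simp: hole_Cons dest: adjacent_Mark_c)
  ultimately have "u = Mark_a \<and> v = Mark_b \<or> u = Mark_b \<and> v = Mark_a" by auto
  then have "odd (length Q)"
    using *[of Q] *[of "rev Q"] p u q hole_rev_tl[OF p(1)] by auto
  moreover have "length h = length Q + 3" using p(2) u q by simp
  ultimately show ?thesis by simp
next
  case c: False
  show ?thesis
  proof (cases "{Mark_a, Mark_b} \<subseteq> set h")
    case True
    then obtain p where p: "hole TX (Mark_a # p)" "set (Mark_a # p) = set h"
      "length (Mark_a # p) = length h"
      using hole_starting_at[OF assms, of Mark_a] by auto
    then have "Mark_b \<in> set p" using True by auto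
    then obtain P Q where PQ: "p = P @ Mark_b # Q" by (auto simp: in_set_conv_decomp)
    have "hole TX (Mark_a # P @ Mark_b # Q)" "hole TX (Mark_a # rev Q @ Mark_b # rev P)"
      using p(1) hole_rev_tl[OF p(1)] PQ by auto
    moreover have "Mark_c \<notin> set P" "Mark_c \<notin> set Q" using c p(2) PQ by auto
    ultimately have "P \<noteq> [] \<Longrightarrow> even (length P) \<longleftrightarrow> odd_join"
      "Q \<noteq> [] \<Longrightarrow> even (length Q) \<longleftrightarrow> odd_join"
      using marker_segment_parity[of P Q] marker_segment_parity[of "rev Q" "rev P"] by auto
    \<comment> \<open>An empty arc makes the markers consecutive, hence adjacent, which happens only
      in the odd block; there an empty arc has the required even size too.\<close>
    moreover have "odd_join" if "P = [] \<or> Q = []"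
      using p(1) PQ that by (auto simp: hole_Cons)
    ultimately have "even (length P + length Q)" by (cases "P = []"; cases "Q = []") auto
    moreover have "length h = length P + length Q + 2" using p(3) PQ by simp
    ultimately show ?thesis by simp
  next
    case False
    then obtain h' where "hole T h'" "length h' = length h"
      using retract_hole[OF assms, of T] c by blast
    then show ?thesis using Berge by (auto simp: Berge_def)
  qed
qed

section \<open>Antiholes of the block\<close>

lemma antihole_even:
  assumes "antihole TX h"
  shows "even (length h)"
proof (rule ccontr)
  assume odd: "odd (length h)"
  have h: "hole (complement TX) h" using assms by (simp add: antihole_def)
  have "length h \<noteq> 5" using hole_of_antihole_5[OF assms] hole_even by (metis odd odd_numeral)
  moreover have "4 \<le> length h" using h by (simp add: hole_def)
  ultimately have len: "7 \<le> length h" using odd by presburger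
  have c: "Mark_c \<notin> set h"
  proof
    assume "Mark_c \<in> set h"
    then obtain p where p: "hole (complement TX) (Mark_c # p)" "length (Mark_c # p) = length h"
      using hole_starting_at[OF h] by metis
    \<comment> \<open>Here \<open>p\<close> has at least six vertices, so positions 1, 2 and 3 are
      interior. In the complement they are antiadjacent to \<open>Mark_c\<close>, which gives it
      three distinct neighbours in the block, one too many.\<close>
    have "p ! k = Mark_a \<or> p ! k = Mark_b" if "k \<in> {1, 2, 3}" for k
    proof (rule adjacent_Mark_c)
      have "p ! k \<in> interior p" using that p len by (auto simp: interior_conv_nth)
      then show "adjacent TX Mark_c (p ! k)" using p by (simp add: hole_Cons)
    qed
    from this[of 1] this[of 2] this[of 3] have "p ! 1 = p ! 2 \<or> p ! 1 = p ! 3 \<or> p ! 2 = p ! 3"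
      by auto
    moreover have "distinct p" using p by (simp add: hole_def)
    ultimately show False using p len by (auto simp: nth_eq_iff_index_eq)
  qed
  show False
  proof (cases "{Mark_a, Mark_b} \<subseteq> set h")
    case True
    then obtain p where p: "hole (complement TX) (Mark_a # p)" "set (Mark_a # p) = set h"
      "length (Mark_a # p) = length h"
      using hole_starting_at[OF h, of Mark_a] by auto
    let ?h = "Mark_a # p"
    have anti: "adjacent TX (?h ! i) (?h ! j)"
      if "i < j" "j < length ?h" "j - i \<notin> {1, length ?h - 1}" for i j
      using p(1) that unfolding hole_def antiadjacent_complement by metis
    obtain j where j: "j < length ?h" "?h ! j = Mark_b"
      using True p(2) by (metis in_set_conv_nth insert_subset)
    \<comment> \<open>Cyclic distance at least 2 from both positions \<open>0\<close> and \<open>j\<close>.\<close>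
    define i where "i = (if j \<le> 3 then 5 else 2 :: nat)"
    have "j \<noteq> 0" using j by (cases j) auto
    have "adjacent TX Mark_a (?h ! i)" using anti[of 0 i] len p(3) by (auto simp: i_def)
    moreover have "adjacent TX Mark_b (?h ! i)"
    proof (cases "j \<le> 3")
      case True
      moreover from this have "5 - j \<notin> {1, length ?h - 1}" using len p(3) \<open>j \<noteq> 0\<close> by auto
      ultimately show ?thesis using anti[of j 5] len p(3) j by (simp add: i_def)
    next
      case False
      moreover from this have "j - 2 \<notin> {1, length ?h - 1}" using j by auto
      ultimately show ?thesis using anti[of 2 j] j adjacent_sym[of TX "?h ! 2"]
        by (simp add: i_def)
    qed
    moreover have "?h ! i \<in> set h" using p(2,3) len nth_mem[of i ?h] by (auto simp: i_def)
    \<comment> \<open>A common neighbour of both markers other than \<open>Mark_c\<close> would lie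
      in \<open>A1\<close> and in \<open>B1\<close>.\<close>
    ultimately show False using c disj1 by (cases "?h ! i") auto
  next
    case False
    then obtain h' where "hole (complement T) h'" "length h' = length h"
      using retract_hole[OF h, of "complement T"] c by blast
    then show ?thesis using Berge odd by (auto simp: Berge_def antihole_def)
  qed
qed

section \<open>Values and switchable pairs of the block\<close>

lemma trigraph_TX: "trigraph TX"
proof -
  have "theta TX e \<in> {-1, 0, 1}" if e: "e \<subseteq> verts TX" "card e = 2" for e
  proof -
    obtain u v where uv: "e = {u, v}" "u \<noteq> v" using e(2) by (auto simp: card_2_iff)
    show ?thesis
    proof (cases "e \<subseteq> Orig ` X1")
      case True
      then obtain x y where xy: "u = Orig x" "v = Orig y" "x \<in> X1" "y \<in> X1" using uv by auto
      then have "theta TX e = theta T {x, y}" using uv theta_Orig by simp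
      then show ?thesis using theta_values[OF trigraph, of x y] uv xy vertex_pair_T[of x y] by auto
    next
      case False
      then show ?thesis by (auto simp: TX odd_block_def even_block_def add_markers_def)
    qed
  qed
  moreover have "finite (verts TX)"
    using trigraph by (auto simp: verts_TX verts_T trigraph_def)
  ultimately show ?thesis by (simp add: trigraph_def)
qed

lemma switchable_closed: "x \<in> X1 \<Longrightarrow> switchable T x y \<Longrightarrow> y \<in> X1"
  using join by (auto simp: proper_two_join_def two_join_def Let_def switchable_def vertex_pair_def)

text \<open>No switchable pair joins a marker to an original vertex. So a component consists of
  markers, with one or two pairs, or is the copy of a component of \<open>T\<close>.\<close>

lemma switchable_component_TX:
  assumes Y: "graph_component (verts TX) (switchable TX) Y"
  shows "card {{u, v} |u v. u \<in> Y \<and> v \<in> Y \<and> switchable TX u v} \<le> 2"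
proof -
  have Y_verts: "Y \<subseteq> verts TX" and Y_conn: "graph_connected Y (switchable TX)"
    and Y_max: "\<And>Z. Y \<subseteq> Z \<Longrightarrow> Z \<subseteq> verts TX \<Longrightarrow> graph_connected Z (switchable TX) \<Longrightarrow> Z = Y"
    using Y unfolding graph_component_def by blast+
  show ?thesis
  proof (cases "Y \<inter> {Mark_a, Mark_b, Mark_c} = {}")
    case False
    then obtain m where m: "m \<in> Y" "m \<in> {Mark_a, Mark_b, Mark_c}" by blast
    have "v \<in> {Mark_a, Mark_b, Mark_c}"
      if "u \<in> {Mark_a, Mark_b, Mark_c}" "switchable TX u v" for u v
      using that by (cases v) auto
    then have sub: "Y \<subseteq> {Mark_a, Mark_b, Mark_c}"
      using m graph_connected_subset[OF Y_conn, of m "{Mark_a, Mark_b, Mark_c}"] by blast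
    have "{{u, v} |u v. u \<in> Y \<and> v \<in> Y \<and> switchable TX u v} \<subseteq>
        (if odd_join then {{Mark_a, Mark_b}} else {{Mark_a, Mark_c}, {Mark_b, Mark_c}})"
      (is "?E \<subseteq> ?M")
    proof
      fix e assume "e \<in> ?E"
      then obtain u v where e: "e = {u, v}" and "u \<in> Y" "v \<in> Y" and uv: "switchable TX u v"
        by blast
      then have "u \<in> {Mark_a, Mark_b, Mark_c}" "v \<in> {Mark_a, Mark_b, Mark_c}" using sub by blast+
      then show "e \<in> ?M" using uv by (auto simp: e insert_commute)
    qed
    then have "card ?E \<le> card ?M" by (rule card_mono[rotated]) simp
    also have "\<dots> \<le> 2" by (simp add: card_insert_if)
    finally show ?thesis .
  next
    case True
    show ?thesis
    proof (cases "Y = {}")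
      case nonempty: False
      define Z where "Z = Orig -` Y"
      have YX: "Y \<subseteq> Orig ` X1"
        using Y_verts True by (auto simp: verts_TX split: if_splits)
      then have YZ: "Y = Orig ` Z" and ZX: "Z \<subseteq> X1" by (auto simp: Z_def)
      have "graph_connected (retract undefined undefined ` Y) (switchable T)"
        by (rule graph_connected_image[OF Y_conn]) (auto simp: YZ)
      then have conn: "graph_connected Z (switchable T)" by (simp add: YZ image_image)
      \<comment> \<open>A connected set of \<open>T\<close> containing \<open>Z\<close> cannot leave
        \<open>X1\<close>, because no switchable pair crosses the 2-join. Its copy is then connected
        in the block, and maximality of \<open>Y\<close> applies.\<close>
      have "W = Z" if W: "Z \<subseteq> W" "W \<subseteq> verts T" "graph_connected W (switchable T)" for W
      proof -
        obtain z where "z \<in> Z" using nonempty YZ by auto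
        then have WX: "W \<subseteq> X1"
          using graph_connected_subset[OF W(3), of z X1] W(1) ZX switchable_closed by blast
        have "graph_connected (Orig ` W) (switchable TX)"
          using WX by (intro graph_connected_image[OF W(3)]) auto
        moreover have "Y \<subseteq> Orig ` W" "Orig ` W \<subseteq> verts TX" using W(1) WX YZ by (auto simp: verts_TX)
        ultimately have "Orig ` W = Orig ` Z" using Y_max YZ by blast
        then show ?thesis by (simp add: inj_image_eq_iff inj_def)
      qed
      then have "graph_component (verts T) (switchable T) Z"
        using conn ZX unfolding graph_component_def verts_T by blast
      then have "card {{u, v} |u v. u \<in> Z \<and> v \<in> Z \<and> switchable T u v} \<le> 2" (is "card ?E \<le> 2")
        using F unfolding class_F_def by blast
      moreover have "{{u, v} |u v. u \<in> Y \<and> v \<in> Y \<and> switchable TX u v} = (`) Orig ` ?E"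
      proof (intro set_eqI iffI)
        fix e assume "e \<in> (`) Orig ` ?E"
        then obtain u v where "e = {Orig u, Orig v}" "u \<in> Z" "v \<in> Z" "switchable T u v" by auto
        then show "e \<in> {{u, v} |u v. u \<in> Y \<and> v \<in> Y \<and> switchable TX u v}"
          using ZX by (intro CollectI exI[of _ "Orig u"] exI[of _ "Orig v"]) (auto simp: YZ)
      next
        fix e assume "e \<in> {{u, v} |u v. u \<in> Y \<and> v \<in> Y \<and> switchable TX u v}"
        then obtain u v where "e = Orig ` {u, v}" "u \<in> Z" "v \<in> Z" "switchable T u v"
          unfolding YZ by auto
        then show "e \<in> (`) Orig ` ?E" by blast
      qed
      moreover have "card ((`) Orig ` ?E) = card ?E"
        by (intro card_image inj_onI) (auto simp: inj_image_eq_iff inj_def)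
      ultimately show ?thesis by simp
    qed simp
  qed
qed

lemma switchable_degree_2_TX:
  assumes v: "v \<in> verts TX" and "x \<noteq> y" and N: "{w. switchable TX v w} = {x, y}"
  shows "strongly_complete TX {v} (verts TX - {v, x, y}) \<and> strongly_adjacent TX x y \<or>
    strongly_anticomplete TX {v} (verts TX - {v, x, y}) \<and> strongly_antiadjacent TX x y"
proof -
  have sw: "switchable TX v w \<longleftrightarrow> w = x \<or> w = y" for w using N by blast
  show ?thesis
  proof (cases v)
    case (Orig u)
    have u: "u \<in> X1" using v Orig by (auto simp: verts_TX split: if_splits)
    obtain x' where x': "x = Orig x'" "switchable T u x'" "x' \<in> X1"
      using sw[of x] Orig by (cases x) auto
    obtain y' where y': "y = Orig y'" "switchable T u y'" "y' \<in> X1"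
      using sw[of y] Orig by (cases y) auto
    have "w = x' \<or> w = y'" if "switchable T u w" for w
      using sw[of "Orig w"] that Orig x' y' u switchable_closed[of u w] by auto
    then have "{w. switchable T u w} = {x', y'}" using x' y' by auto
    moreover have "x' \<noteq> y'" "u \<in> verts T" using x' y' \<open>x \<noteq> y\<close> u verts_T by auto
    ultimately have cases: "strongly_complete T {u} (verts T - {u, x', y'}) \<or>
      strongly_anticomplete T {u} (verts T - {u, x', y'}) \<and> strongly_antiadjacent T x' y'"
      using F unfolding class_F_def by blast
    obtain a b where ab: "a \<in> A2" "b \<in> B2" using nonempty by blast
    \<comment> \<open>Switchable neighbours of \<open>u\<close> stay in \<open>X1\<close>, so the
      degree-two condition constrains \<open>u\<close> against all of \<open>X2\<close>.\<close>
    have X2: "X2 \<subseteq> verts T - {u, x', y'}" using u x' y' disj verts_T by auto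
    have "\<not> strongly_complete T {u} (verts T - {u, x', y'})"
    proof
      assume "strongly_complete T {u} (verts T - {u, x', y'})"
      then have "theta T {u, w} = 1" if "w \<in> X2" for w
        using that X2 unfolding strongly_complete_def strongly_adjacent_def by blast
      \<comment> \<open>Being strongly adjacent to \<open>a\<close> in \<open>A2\<close> forces
        \<open>u\<close> into \<open>A1\<close>, and being strongly adjacent to \<open>b\<close> in
        \<open>B2\<close> forces it into \<open>B1\<close>.\<close>
      then have "u \<in> A1" "u \<in> B1"
        using theta_cross[OF u, of a] theta_cross[OF u, of b] ab disj2
        by (auto split: if_splits)
      then show False using disj1 by blast
    qed
    then have anti: "strongly_anticomplete T {u} (verts T - {u, x', y'})"
      and xy: "strongly_antiadjacent T x' y'" using cases by auto
    have "theta T {u, w} = -1" if "w \<in> X2" for w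
      using anti that X2 unfolding strongly_anticomplete_def strongly_antiadjacent_def by blast
    \<comment> \<open>Hence \<open>u\<close> is also strongly antiadjacent to both
      \<open>Mark_a\<close> and \<open>Mark_b\<close>.\<close>
    then have "u \<notin> A1" "u \<notin> B1"
      using theta_cross[OF u, of a] theta_cross[OF u, of b] ab by (auto split: if_splits)
    have "strongly_antiadjacent TX v w" if w: "w \<in> verts TX - {v, x, y}" for w
    proof (cases w)
      case (Orig z)
      then have "z \<in> X1" "z \<notin> {u, x', y'}"
        using w \<open>v = Orig u\<close> x' y' by (auto simp: verts_TX split: if_splits)
      then have "strongly_antiadjacent T u z"
        using anti by (auto simp: strongly_anticomplete_def verts_T)
      then show ?thesis using \<open>v = Orig u\<close> Orig u \<open>z \<in> X1\<close>
        by (auto simp: strongly_antiadjacent_def vertex_pair_TX vertex_pair_T theta_Orig)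
    qed (use w Orig v \<open>u \<notin> A1\<close> \<open>u \<notin> B1\<close> theta_marker_Orig[of u] in
        \<open>auto simp: strongly_antiadjacent_def vertex_pair_def insert_commute\<close>)
    moreover have "strongly_antiadjacent TX x y"
      using xy x' y' by (auto simp: strongly_antiadjacent_def vertex_pair_TX vertex_pair_T theta_Orig)
    ultimately show ?thesis by (simp add: strongly_anticomplete_def)
  next
    case Mark_a
    \<comment> \<open>\<open>Mark_a\<close> is in exactly one switchable pair, with
      \<open>Mark_b\<close> or with \<open>Mark_c\<close>, so it does not have degree two. The same
      holds for \<open>Mark_b\<close>.\<close>
    then show ?thesis using sw[of x] sw[of y] \<open>x \<noteq> y\<close> by (cases x; cases y) auto
  next
    case Mark_b
    then show ?thesis using sw[of x] sw[of y] \<open>x \<noteq> y\<close> by (cases x; cases y) auto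
  next
    case Mark_c
    then have "\<not> odd_join" using v by (auto simp: verts_TX split: if_splits)
    \<comment> \<open>In the even block \<open>Mark_c\<close> does have degree two, and it satisfies
      the anticomplete alternative.\<close>
    then have "{x, y} = {Mark_a, Mark_b}" 
      using Mark_c sw[of Mark_a] sw[of Mark_b] by auto
    then have "strongly_antiadjacent TX x y" "verts TX - {v, x, y} = Orig ` X1"
      using \<open>\<not> odd_join\<close> theta_markers(1) Mark_c
      by (auto simp: strongly_antiadjacent_def vertex_pair_def verts_TX doubleton_eq_iff
          insert_commute)
    moreover have "strongly_antiadjacent TX Mark_c (Orig z)" if "z \<in> X1" for z
      using that \<open>\<not> odd_join\<close>
      by (auto simp: strongly_antiadjacent_def vertex_pair_TX theta_marker_Orig)
    ultimately show ?thesis using Mark_c by (simp add: strongly_anticomplete_def)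
  qed
qed

lemma TX_in_class_F: "TX \<in> class_F"
  unfolding class_F_def Berge_def mem_Collect_eq
  using trigraph_TX hole_even antihole_even switchable_component_TX switchable_degree_2_TX by blast

end

section \<open>Both kinds of blocks\<close>

theorem theorem4p1:
  fixes T :: "'a trigraph" and X :: "'a set" and TX :: "'a block_vertex trigraph"
  assumes "T \<in> class_F"
    and "\<nexists>A B. balanced_skew_partition T A B"
    and "fragment T X"
    and "block_of_decomposition T X TX"
  shows "TX \<in> class_F"
proof -
  obtain A1 B1 C1 A2 B2 C2 where
    "proper_two_join T A1 B1 C1 A2 B2 C2 \<and>
        TX = (if odd_two_join T A1 B1 C1 A2 B2 C2
              then odd_block T A1 B1 C1 else even_block T A1 B1 C1) \<or>
      proper_complement_two_join T A1 B1 C1 A2 B2 C2 \<and>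
        TX = (if odd_two_join (complement T) A1 B1 C1 A2 B2 C2
              then odd_complement_block T A1 B1 C1 else even_complement_block T A1 B1 C1)"
    using assms(4) unfolding block_of_decomposition_def by blast
  then show ?thesis
  proof (elim disjE conjE)
    assume "proper_two_join T A1 B1 C1 A2 B2 C2"
      "TX = (if odd_two_join T A1 B1 C1 A2 B2 C2
             then odd_block T A1 B1 C1 else even_block T A1 B1 C1)"
    then interpret two_join_block T A1 B1 C1 A2 B2 C2 TX
      using assms(1) by unfold_locales
    show ?thesis by (rule TX_in_class_F)
  next
    assume join: "proper_complement_two_join T A1 B1 C1 A2 B2 C2"
      and TX_eq: "TX = (if odd_two_join (complement T) A1 B1 C1 A2 B2 C2
             then odd_complement_block T A1 B1 C1 else even_complement_block T A1 B1 C1)"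
    \<comment> \<open>This is the block of the 2-join of \<open>complement T\<close> with the same
      split; on vertex pairs \<open>TX\<close> is its complement.\<close>
    define TX' where "TX' = (if odd_two_join (complement T) A1 B1 C1 A2 B2 C2
      then odd_block (complement T) A1 B1 C1 else even_block (complement T) A1 B1 C1)"
    have "complement T \<in> class_F" using assms(1) by (rule class_F_complement) simp_all
    then interpret two_join_block "complement T" A1 B1 C1 A2 B2 C2 TX'
      using join TX'_def by unfold_locales (simp_all add: proper_complement_two_join_def)
    show ?thesis using TX_in_class_F
    proof (rule class_F_complement)
      show "verts TX = verts TX'"
        by (auto simp: TX_eq TX'_def odd_block_def even_block_def odd_complement_block_def
            even_complement_block_def add_markers_def)
      \<comment> \<open>Disjointness of the split makes \<open>B1 \<union> C1\<close> the set of
        vertices of \<open>X1\<close> outside \<open>A1\<close>, and \<open>A1 \<union> C1\<close>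
        the set of those outside \<open>B1\<close>. So each marker of the complement block is
        complete exactly to the vertices that the marker of \<open>TX'\<close> misses.\<close>
      show "theta TX {u, v} = - theta TX' {u, v}" if "vertex_pair TX' u v" for u v
        using that disj1 unfolding vertex_pair_def verts_TX
        by (cases u; cases v)
          (auto simp: TX_eq TX'_def odd_block_def even_block_def odd_complement_block_def
            even_complement_block_def add_markers_def star_def doubleton_eq_iff split: if_splits)
    qed
  qed
qed

end
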